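(* Let $(\Omega,\mathcal F)$ be a measurable space, $\mathcal G\subseteq\mathcal F$ a sub-$\sigma$-algebra, and let $c:\mathcal F\to[0,1]$ be a capacity which is continuous from below. Assume that there exists a real-valued $\mathcal F$-measurable function $Z$ whose distribution function $G_Z$ with respect to $c$ is continuous and satisfies $\lim_{x\to-\infty}G_Z(x)=0$ and $\lim_{x\to+\infty}G_Z(x)=1$. Let $\rho:\chi(\mathcal F)\to\chi(\mathcal G)$ be an operator (conditional risk measure) satisfying, for all $X,Y\in\chi(\mathcal F)$: (i) if $X\preceq_{st,c}Y$, then $\rho(X)\le\rho(Y)$; (ii) if $X$ and $Y$ are comonotonic, then $\rho(X+Y)=\rho(X)+\rho(Y)$; (iii) for every $a\in\mathbb R$, $\rho(X+a)=\rho(X)+a$; (iv) for every real $a\ge0$, $\rho(aX)=a\rho(X)$. Then there exists a $\mathcal G$-random distortion function $\phi^{\mathcal G}$ such that $$\rho(X)=\mathbb E_{\phi^{\mathcal G}\circ c}(X)\quad\text{for all }X\in\chi(\mathcal F).$$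
   Context: $\chi(\mathcal F)$ (resp. $\chi(\mathcal G)$) is the set of all bounded real-valued $\mathcal F$-measurable (resp. $\mathcal G$-measurable) functions on $\Omega$. Equalities and inequalities between functions are pointwise for all $\omega\in\Omega$. A ($\mathcal G$-)conditional risk measure is any operator $\rho:\chi(\mathcal F)\to\chi(\mathcal G)$. A capacity on $(\Omega,\mathcal F)$ is a set function $c:\mathcal F\to[0,1]$ with $c(\emptyset)=0$, $c(\Omega)=1$, and $c(A)\le c(B)$ whenever $A\subset B$, $A,B\in\mathcal F$. It is continuous from below if $\lim_n c(A_n)=c(\bigcup_n A_n)$ for every sequence $(A_n)$ in $\mathcal F$ with $A_n\subset A_{n+1}$ for all $n$. The distribution function of a real-valued measurable $X$ with respect to $c$ is $G_X(x):=1-c(X>x)$, $x\in\mathbb R$. The Choquet integral of $X\in\chi(\mathcal F)$ with respect to $c$ is $\mathbb E_c(X)=\int_0^{+\infty}c(X>x)\,dx+\int_{-\infty}^0[c(X>x)-1]\,dx$. First-order stochastic dominance with respect to $c$: $X\preceq_{st,c}Y$ means $\mathbb E_c(u(X))\le\mathbb E_c(u(Y))$ for all (deterministic) non-decreasing functions $u:\mathbb R\to\mathbb R$. $X$ and $Y$ are comonotonic if $(X(\omega)-X(\bar\omega))(Y(\omega)-Y(\bar\omega))\ge0$ for all $(\omega,\bar\omega)\in\Omega\times\Omega$. A $\mathcal G$-random distortion function is a map $\phi^{\mathcal G}:\Omega\times[0,1]\to[0,1]$ such that for every $\omega\in\Omega$ the function $t\mapsto\phi^{\mathcal G}(\omega,t)$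 is non-decreasing with $\phi^{\mathcal G}(\omega,0)=0$, $\phi^{\mathcal G}(\omega,1)=1$, and for every $t\in[0,1]$ the function $\omega\mapsto\phi^{\mathcal G}(\omega,t)$ is $\mathcal G$-measurable. The $\mathcal G$-randomly distorted Choquet integral of $X\in\chi(\mathcal F)$ is defined, for all $\omega\in\Omega$, by $$\mathbb E_{\phi^{\mathcal G}\circ c}(X)(\omega)=\int_0^{+\infty}\phi^{\mathcal G}(\omega,c(X>x))\,dx+\int_{-\infty}^0[\phi^{\mathcal G}(\omega,c(X>x))-1]\,dx.$$ *)

theory Defs
  imports "HOL-Probability.Probability"
begin

text \<open>
  A measurable space is represented by a value of type \<open>'a measure\<close>, of which only \<open>space\<close> and
  \<open>sets\<close> are used. Random variables are total functions on the type \<open>'a\<close>; every condition on them is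
  restricted to the points of \<open>space M\<close>, so their values elsewhere are irrelevant.
\<close>

definition bounded_measurable :: "'a measure \<Rightarrow> ('a \<Rightarrow> real) set" where
  "bounded_measurable M = {X \<in> borel_measurable M. bounded (X ` space M)}"

definition capacity :: "'a measure \<Rightarrow> ('a set \<Rightarrow> real) \<Rightarrow> bool" where
  "capacity M c \<longleftrightarrow>
     c \<in> sets M \<rightarrow> {0..1} \<and> c {} = 0 \<and> c (space M) = 1 \<and>
     (\<forall>A\<in>sets M. \<forall>B\<in>sets M. A \<subseteq> B \<longrightarrow> c A \<le> c B)"

definition continuous_from_below :: "'a measure \<Rightarrow> ('a set \<Rightarrow> real) \<Rightarrow> bool" where
  "continuous_from_below M c \<longleftrightarrow>
     (\<forall>A :: nat \<Rightarrow> 'a set. range A \<subseteq> sets M \<longrightarrow> (\<forall>n. A n \<subseteq> A (Suc n)) \<longrightarrow>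
        (\<lambda>n. c (A n)) \<longlonglongrightarrow> c (\<Union>n. A n))"

definition distribution_function ::
    "'a measure \<Rightarrow> ('a set \<Rightarrow> real) \<Rightarrow> ('a \<Rightarrow> real) \<Rightarrow> real \<Rightarrow> real" where
  "distribution_function M c X x = 1 - c {\<omega>\<in>space M. X \<omega> > x}"

text \<open>
  For a capacity and a bounded measurable \<open>X\<close> both integrands below are monotone, bounded and vanish
  outside a bounded interval, so the Lebesgue integrals exist and agree with the improper Riemann ones.
\<close>

definition choquet_integral :: "'a measure \<Rightarrow> ('a set \<Rightarrow> real) \<Rightarrow> ('a \<Rightarrow> real) \<Rightarrow> real" where
  "choquet_integral M c X =
     (LBINT x:{0..}. c {\<omega>\<in>space M. X \<omega> > x}) +
     (LBINT x:{..0}. (c {\<omega>\<in>space M. X \<omega> > x} - 1))"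

definition st_dominated ::
    "'a measure \<Rightarrow> ('a set \<Rightarrow> real) \<Rightarrow> ('a \<Rightarrow> real) \<Rightarrow> ('a \<Rightarrow> real) \<Rightarrow> bool" where
  "st_dominated M c X Y \<longleftrightarrow>
     (\<forall>u :: real \<Rightarrow> real. mono u \<longrightarrow>
        choquet_integral M c (\<lambda>\<omega>. u (X \<omega>)) \<le> choquet_integral M c (\<lambda>\<omega>. u (Y \<omega>)))"

definition comonotonic :: "'a measure \<Rightarrow> ('a \<Rightarrow> real) \<Rightarrow> ('a \<Rightarrow> real) \<Rightarrow> bool" where
  "comonotonic M X Y \<longleftrightarrow>
     (\<forall>\<omega>\<in>space M. \<forall>\<omega>'\<in>space M. (X \<omega> - X \<omega>') * (Y \<omega> - Y \<omega>') \<ge> 0)"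

definition random_distortion_function :: "'a measure \<Rightarrow> ('a \<Rightarrow> real \<Rightarrow> real) \<Rightarrow> bool" where
  "random_distortion_function G \<phi> \<longleftrightarrow>
     (\<forall>\<omega>\<in>space G. \<phi> \<omega> \<in> {0..1} \<rightarrow> {0..1} \<and> mono_on {0..1} (\<phi> \<omega>) \<and> \<phi> \<omega> 0 = 0 \<and> \<phi> \<omega> 1 = 1) \<and>
     (\<forall>t\<in>{0..1}. (\<lambda>\<omega>. \<phi> \<omega> t) \<in> borel_measurable G)"

definition distorted_choquet_integral ::
    "'a measure \<Rightarrow> ('a \<Rightarrow> real \<Rightarrow> real) \<Rightarrow> ('a set \<Rightarrow> real) \<Rightarrow> ('a \<Rightarrow> real) \<Rightarrow> 'a \<Rightarrow> real" where
  "distorted_choquet_integral M \<phi> c X \<omega> =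
     (LBINT x:{0..}. \<phi> \<omega> (c {\<omega>'\<in>space M. X \<omega>' > x})) +
     (LBINT x:{..0}. (\<phi> \<omega> (c {\<omega>'\<in>space M. X \<omega>' > x}) - 1))"

end

theory Submission
  imports Defs
begin

text \<open>
  Dominance with respect to \<open>c\<close> between indicators is comparison of capacities, so \<open>\<rho> (indicator A)\<close> is a
  function of \<open>c A\<close>; as the level sets of \<open>Z\<close> attain every capacity in \<open>[0, 1]\<close>, this function is a
  random distortion. A bounded \<open>X\<close> is squeezed, up to a mesh width, by a sum of comonotonic multiples of
  the indicators of its upper level sets. Comonotonic additivity turns the value of \<open>\<rho>\<close> on this sum into a
  Riemann sum of the monotone integrand of the distorted Choquet integral.
\<close>

section \<open>Integrals of tail functions\<close>

text \<open>Models \<open>x \<mapsto> \<phi> (c {X > x})\<close> for \<open>X\<close> with values in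
  \<open>{-K..K}\<close>. The inequalities are asymmetric because level sets are strict:
  \<open>{X > K}\<close> is empty, but \<open>{X > -K}\<close> may miss points where
  \<open>X\<close> equals \<open>-K\<close>.\<close>

definition tail_function :: "real \<Rightarrow> (real \<Rightarrow> real) \<Rightarrow> bool" where
  "tail_function K h \<longleftrightarrow> antimono h \<and> (\<forall>x < - K. h x = 1) \<and> (\<forall>x\<ge>K. h x = 0)"

lemma set_integrable_antimono:
  fixes h :: "real \<Rightarrow> real"
  assumes "antimono h"
  shows "set_integrable lborel {a..b} h"
  unfolding set_integrable_def
proof (rule integrableI_bounded_set_indicator[where B = "max \<bar>h a\<bar> \<bar>h b\<bar>"])
  have "mono (\<lambda>x. - h x)"
    using assms by (auto simp: monotone_def)
  then have "(\<lambda>x. - (- h x)) \<in> borel_measurable borel"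
    by (intro borel_measurable_uminus borel_measurable_mono)
  then show "h \<in> borel_measurable lborel"
    by simp
  have "\<bar>h x\<bar> \<le> max \<bar>h a\<bar> \<bar>h b\<bar>" if "x \<in> {a..b}" for x
    using antimonoD[OF assms, of a x] antimonoD[OF assms, of x b] that by auto
  then show "AE x in lborel. x \<in> {a..b} \<longrightarrow> norm (h x) \<le> max \<bar>h a\<bar> \<bar>h b\<bar>"
    by simp
qed (auto simp: emeasure_lborel_Icc_eq)

lemma integrable_on_antimono:
  fixes h :: "real \<Rightarrow> real"
  assumes "antimono h"
  shows "h integrable_on {a..b}"
  using set_borel_integral_eq_integral(1)[OF set_integrable_antimono[OF assms]] .

text \<open>Both integrands vanish outside \<open>{-K..K}\<close>. On \<open>{-K..0}\<close> the
  subtracted 1 contributes \<open>-K\<close>, and what remains joins into one integral over a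
  compact interval, to which Riemann sums apply.\<close>

lemma tail_integral_eq:
  assumes h: "tail_function K h" and K: "0 \<le> K"
  shows "(LBINT x:{0..}. h x) + (LBINT x:{..0}. (h x - 1)) = integral {-K..K} h - K"
proof -
  have anti: "antimono h" and one: "\<And>x. x < -K \<Longrightarrow> h x = 1" and zero: "\<And>x. x \<ge> K \<Longrightarrow> h x = 0"
    using h by (auto simp: tail_function_def)
  have anti1: "antimono (\<lambda>x. h x - 1)"
    using anti by (auto simp: monotone_def)
  have "(LBINT x:{0..}. h x) = (LBINT x:{0..K}. h x)"
    unfolding set_lebesgue_integral_def
    by (rule Bochner_Integration.integral_cong) (auto simp: indicator_def zero)
  also have "\<dots> = integral {0..K} h"
    by (rule set_borel_integral_eq_integral(2)[OF set_integrable_antimono[OF anti]])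
  finally have 1: "(LBINT x:{0..}. h x) = integral {0..K} h" .
  have "(LBINT x:{..0}. (h x - 1)) = (LBINT x:{-K..0}. (h x - 1))"
    unfolding set_lebesgue_integral_def
    by (rule Bochner_Integration.integral_cong) (auto simp: indicator_def one)
  also have "\<dots> = integral {-K..0} (\<lambda>x. h x - 1)"
    by (rule set_borel_integral_eq_integral(2)[OF set_integrable_antimono[OF anti1]])
  also have "\<dots> = integral {-K..0} h - K"
    using K by (subst integral_diff) (auto intro: integrable_on_antimono anti)
  finally have 2: "(LBINT x:{..0}. (h x - 1)) = integral {-K..0} h - K" .
  have "integral {-K..0} h + integral {0..K} h = integral {-K..K} h"
    using K by (intro Henstock_Kurzweil_Integration.integral_combine integrable_on_antimono anti) auto
  with 1 2 show ?thesis by simp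
qed

text \<open>Left-endpoint sums of a decreasing function are upper sums. The excess on each cell is
  at most \<open>d\<close> times the drop of \<open>h\<close> across it, and these drops
  telescope.\<close>

lemma antimono_Riemann_sum_bounds:
  fixes h :: "real \<Rightarrow> real"
  assumes h: "antimono h" and d: "0 \<le> d"
  shows "integral {a..a + real n * d} h \<le> d * (\<Sum>i<n. h (a + real i * d))
       \<and> d * (\<Sum>i<n. h (a + real i * d)) \<le> integral {a..a + real n * d} h + d * (h a - h (a + real n * d))"
proof (induction n)
  case 0
  then show ?case by simp
next
  case (Suc n)
  define p q where "p = a + real n * d" and "q = a + real (Suc n) * d"
  have pq: "a \<le> p" "p \<le> q" "q - p = d"
    using d by (auto simp: p_def q_def algebra_simps)
  have int: "h integrable_on {u..v}" for u v
    by (rule integrable_on_antimono[OF h])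
  have "integral {a..p} h + integral {p..q} h = integral {a..q} h"
    using pq by (intro Henstock_Kurzweil_Integration.integral_combine int) auto
  moreover have "integral {p..q} h \<le> integral {p..q} (\<lambda>_. h p)"
    using h by (intro integral_le int) (auto simp: antimonoD)
  moreover have "integral {p..q} (\<lambda>_. h q) \<le> integral {p..q} h"
    using h by (intro integral_le int) (auto simp: antimonoD)
  ultimately have "integral {a..q} h \<le> integral {a..p} h + d * h p"
      "integral {a..p} h + d * h q \<le> integral {a..q} h"
    using pq by auto
  with Suc.IH show ?case
    unfolding p_def q_def by (auto simp: distrib_left right_diff_distrib)
qed

section \<open>Capacities and dominance\<close>

lemma bounded_measurableD:
  assumes "X \<in> bounded_measurable M"
  shows "X \<in> borel_measurable M" "\<exists>K>0. \<forall>\<omega>\<in>space M. \<bar>X \<omega>\<bar> \<le> K"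
  using assms unfolding bounded_measurable_def bounded_pos by auto

lemma bounded_measurableI:
  assumes "X \<in> borel_measurable M" "\<And>\<omega>. \<omega> \<in> space M \<Longrightarrow> \<bar>X \<omega>\<bar> \<le> K"
  shows "X \<in> bounded_measurable M"
  using assms unfolding bounded_measurable_def bounded_iff by auto

text \<open>Dominance ranges over arbitrary monotone \<open>u\<close>. Monotonicity alone supplies
  both measurability and a bound, since \<open>u (X \<omega>)\<close> stays between
  \<open>u (-K)\<close> and \<open>u K\<close>.\<close>

lemma bounded_measurable_mono_comp:
  assumes X: "X \<in> bounded_measurable M" and u: "mono u"
  shows "(\<lambda>\<omega>. u (X \<omega>)) \<in> bounded_measurable M"
proof -
  obtain K where K: "\<And>\<omega>. \<omega> \<in> space M \<Longrightarrow> \<bar>X \<omega>\<bar> \<le> K"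
    using bounded_measurableD(2)[OF X] by auto
  have "\<bar>u (X \<omega>)\<bar> \<le> max \<bar>u K\<bar> \<bar>u (-K)\<bar>" if "\<omega> \<in> space M" for \<omega>
    using monoD[OF u, of "X \<omega>" K] monoD[OF u, of "-K" "X \<omega>"] K[OF that] by linarith
  then show ?thesis
    by (intro bounded_measurableI
        measurable_compose[OF bounded_measurableD(1)[OF X] borel_measurable_mono[OF u]])
qed

lemma bounded_measurable_indicator:
  assumes "A \<in> sets M"
  shows "(indicator A :: _ \<Rightarrow> real) \<in> bounded_measurable M"
  using assms by (intro bounded_measurableI[where K = 1]) (auto simp: indicator_def)

lemma upper_level_set_sets:
  fixes X :: "'a \<Rightarrow> real"
  assumes "X \<in> borel_measurable M"
  shows "{\<omega>\<in>space M. X \<omega> > x} \<in> sets M"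
  using assms by measurable

lemma capacity_range: "capacity M c \<Longrightarrow> A \<in> sets M \<Longrightarrow> c A \<in> {0..1}"
  unfolding capacity_def by auto

text \<open>Serves two purposes: the identity as \<open>\<phi>\<close> gives the plain Choquet
  integrand, and a distortion at a fixed \<open>\<omega>\<close> gives the distorted one.\<close>

lemma tail_function_capacity:
  assumes c: "capacity M c" and X: "X \<in> borel_measurable M"
    and K: "\<And>\<omega>. \<omega> \<in> space M \<Longrightarrow> \<bar>X \<omega>\<bar> \<le> K"
    and \<phi>: "mono_on {0..1} \<phi>" "\<phi> 0 = 0" "\<phi> 1 = 1"
  shows "tail_function K (\<lambda>x. \<phi> (c {\<omega>\<in>space M. X \<omega> > x}))"
  unfolding tail_function_def
proof (intro conjI allI impI antimonoI)
  fix x y :: real assume "x \<le> y"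
  then have "{\<omega>\<in>space M. X \<omega> > y} \<subseteq> {\<omega>\<in>space M. X \<omega> > x}"
    by auto
  then have "c {\<omega>\<in>space M. X \<omega> > y} \<le> c {\<omega>\<in>space M. X \<omega> > x}"
    using c upper_level_set_sets[OF X] unfolding capacity_def by blast
  then show "\<phi> (c {\<omega>\<in>space M. X \<omega> > y}) \<le> \<phi> (c {\<omega>\<in>space M. X \<omega> > x})"
    using capacity_range[OF c upper_level_set_sets[OF X]] by (intro mono_onD[OF \<phi>(1)])
next
  fix x assume "x < -K"
  then have "{\<omega>\<in>space M. X \<omega> > x} = space M"
    using K by force
  then show "\<phi> (c {\<omega>\<in>space M. X \<omega> > x}) = 1"
    using c \<phi> by (simp add: capacity_def)
next
  fix x assume "x \<ge> K"
  then have "{\<omega>\<in>space M. X \<omega> > x} = {}"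
    using K by force
  then show "\<phi> (c {\<omega>\<in>space M. X \<omega> > x}) = 0"
    using c \<phi> by (simp only: capacity_def)
qed

lemma choquet_integral_mono:
  assumes c: "capacity M c" and X: "X \<in> bounded_measurable M" and Y: "Y \<in> bounded_measurable M"
    and le: "\<And>x. c {\<omega>\<in>space M. X \<omega> > x} \<le> c {\<omega>\<in>space M. Y \<omega> > x}"
  shows "choquet_integral M c X \<le> choquet_integral M c Y"
proof -
  obtain K L where K: "K > 0" "\<And>\<omega>. \<omega> \<in> space M \<Longrightarrow> \<bar>X \<omega>\<bar> \<le> K"
    and L: "L > 0" "\<And>\<omega>. \<omega> \<in> space M \<Longrightarrow> \<bar>Y \<omega>\<bar> \<le> L"
    using bounded_measurableD(2)[OF X] bounded_measurableD(2)[OF Y] by metis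
  \<comment> \<open>A common bound puts both tails on the same interval, so that comparing integrals
    reduces to comparing integrands.\<close>
  let ?m = "max K L"
  have tail: "tail_function ?m (\<lambda>x. c {\<omega>\<in>space M. V \<omega> > x})"
    if "V \<in> bounded_measurable M" "\<And>\<omega>. \<omega> \<in> space M \<Longrightarrow> \<bar>V \<omega>\<bar> \<le> ?m" for V
    using tail_function_capacity[OF c bounded_measurableD(1)[OF that(1)] that(2), where \<phi> = "\<lambda>t. t"]
    by (auto simp: mono_on_def)
  have tX: "tail_function ?m (\<lambda>x. c {\<omega>\<in>space M. X \<omega> > x})"
    using K(2) by (intro tail X) force
  have tY: "tail_function ?m (\<lambda>x. c {\<omega>\<in>space M. Y \<omega> > x})"
    using L(2) by (intro tail Y) force
  show ?thesis
    unfolding choquet_integral_def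
    using K(1) le tX tY tail_integral_eq[OF tX] tail_integral_eq[OF tY]
    by (auto simp: tail_function_def intro!: integral_le integrable_on_antimono)
qed

section \<open>Sufficient conditions for dominance and comonotonicity\<close>

lemma st_dominatedI:
  assumes "capacity M c" "X \<in> bounded_measurable M" "Y \<in> bounded_measurable M"
    and "\<And>(u :: real \<Rightarrow> real) x. mono u \<Longrightarrow> c {\<omega>\<in>space M. u (X \<omega>) > x} \<le> c {\<omega>\<in>space M. u (Y \<omega>) > x}"
  shows "st_dominated M c X Y"
  unfolding st_dominated_def
proof (intro allI impI)
  fix u :: "real \<Rightarrow> real" assume u: "mono u"
  show "choquet_integral M c (\<lambda>\<omega>. u (X \<omega>)) \<le> choquet_integral M c (\<lambda>\<omega>. u (Y \<omega>))"
    using assms(4)[OF u]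
    by (rule choquet_integral_mono[OF assms(1) bounded_measurable_mono_comp[OF assms(2) u]
          bounded_measurable_mono_comp[OF assms(3) u]])
qed

text \<open>For monotone \<open>u\<close>, every upper level set of \<open>u (X \<omega>)\<close>
  lies in that of \<open>u (Y \<omega>)\<close>. Through this, monotonicity in the dominance order
  yields ordinary pointwise monotonicity of \<open>\<rho>\<close>.\<close>

lemma st_dominated_pointwise:
  assumes c: "capacity M c" and X: "X \<in> bounded_measurable M" and Y: "Y \<in> bounded_measurable M"
    and le: "\<And>\<omega>. \<omega> \<in> space M \<Longrightarrow> X \<omega> \<le> Y \<omega>"
  shows "st_dominated M c X Y"
proof (rule st_dominatedI[OF c X Y])
  fix u :: "real \<Rightarrow> real" and x assume u: "mono u"
  have "{\<omega>\<in>space M. u (X \<omega>) > x} \<subseteq> {\<omega>\<in>space M. u (Y \<omega>) > x}"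
    using monoD[OF u le] by force
  then show "c {\<omega>\<in>space M. u (X \<omega>) > x} \<le> c {\<omega>\<in>space M. u (Y \<omega>) > x}"
    using c upper_level_set_sets[OF bounded_measurableD(1)[OF bounded_measurable_mono_comp[OF X u]]]
      upper_level_set_sets[OF bounded_measurableD(1)[OF bounded_measurable_mono_comp[OF Y u]]]
    unfolding capacity_def by blast
qed

lemma st_dominated_indicator:
  assumes c: "capacity M c" and A: "A \<in> sets M" and B: "B \<in> sets M" and le: "c A \<le> c B"
  shows "st_dominated M c (indicator A) (indicator B)"
proof (rule st_dominatedI[OF c bounded_measurable_indicator[OF A] bounded_measurable_indicator[OF B]])
  fix u :: "real \<Rightarrow> real" and x assume u: "mono u"
  \<comment> \<open>The composition takes only the values \<open>u 0 \<le> u 1\<close>. Which of the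
    three sets occurs depends on \<open>u\<close> and \<open>x\<close> but not on \<open>E\<close>,
    so \<open>A\<close> and \<open>B\<close> always fall into the same case.\<close>
  have level: "{\<omega>\<in>space M. u (indicator E \<omega>) > x} =
      (if x < u 0 then space M else if x < u 1 then E else {})" if "E \<in> sets M" for E
  proof -
    have "u 0 \<le> u 1"
      using u by (simp add: monoD)
    moreover have "u (indicator E \<omega>) = (if \<omega> \<in> E then u 1 else u 0)" for \<omega>
      by simp
    ultimately show ?thesis
      using sets.sets_into_space[OF that] by (cases "x < u 0"; cases "x < u 1") auto
  qed
  show "c {\<omega>\<in>space M. u (indicator A \<omega>) > x} \<le> c {\<omega>\<in>space M. u (indicator B \<omega>) > x}"
    using le by (simp add: level A B)
qed

lemma comonotonic_mono_comp:
  fixes f g :: "real \<Rightarrow> real"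
  assumes "mono f" "mono g"
  shows "comonotonic M (\<lambda>\<omega>. f (X \<omega>)) (\<lambda>\<omega>. g (X \<omega>))"
  unfolding comonotonic_def
proof (intro ballI)
  fix \<omega> \<omega>'
  show "(f (X \<omega>) - f (X \<omega>')) * (g (X \<omega>) - g (X \<omega>')) \<ge> 0"
  proof (cases "X \<omega> \<le> X \<omega>'")
    case True
    then show ?thesis
      using monoD[OF assms(1) True] monoD[OF assms(2) True] by (intro mult_nonpos_nonpos) auto
  next
    case False
    then have "X \<omega>' \<le> X \<omega>"
      by simp
    then show ?thesis
      using monoD[OF assms(1)] monoD[OF assms(2)] by (intro mult_nonneg_nonneg) auto
  qed
qed

text \<open>The intermediate value theorem gives \<open>z\<close> where the distribution function
  equals \<open>1 - t\<close>, so \<open>{Z > z}\<close> has capacity \<open>t\<close>. The limits 0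
  and 1 need not be attained, so the extreme capacities come from the empty set and the whole
  space.\<close>

lemma capacity_attains:
  assumes c: "capacity M c" and Z: "Z \<in> borel_measurable M"
    and cont: "continuous_on UNIV (distribution_function M c Z)"
    and bot: "(distribution_function M c Z \<longlongrightarrow> 0) at_bot"
    and top: "(distribution_function M c Z \<longlongrightarrow> 1) at_top"
    and t: "t \<in> {0..1}"
  shows "\<exists>A\<in>sets M. c A = t"
proof -
  consider "t = 0" | "t = 1" | "0 < t" "t < 1"
    using t by force
  then show ?thesis
  proof cases
    case 1
    then show ?thesis using c by (auto simp: capacity_def)
  next
    case 2
    then show ?thesis using c by (auto simp: capacity_def)
  next
    case 3
    let ?G = "distribution_function M c Z"
    \<comment> \<open>The sign conditions here and on \<open>y\<close> ensure
      \<open>x \<le> y\<close>, as the intermediate value theorem requires.\<close>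
    have "eventually (\<lambda>x. ?G x < 1 - t \<and> x \<le> 0) at_bot"
      using order_tendstoD(2)[OF bot, of "1 - t"] 3 eventually_le_at_bot[of "0::real"]
      by (auto intro: eventually_conj)
    then obtain x where x: "?G x < 1 - t" "x \<le> 0"
      using eventually_happens[of _ "at_bot :: real filter"] by auto
    have "eventually (\<lambda>x. ?G x > 1 - t \<and> x \<ge> 0) at_top"
      using order_tendstoD(1)[OF top, of "1 - t"] 3 eventually_ge_at_top[of "0::real"]
      by (auto intro: eventually_conj)
    then obtain y where y: "?G y > 1 - t" "y \<ge> 0"
      using eventually_happens[of _ "at_top :: real filter"] by auto
    obtain z where "?G z = 1 - t"
      using IVT'[of ?G x "1 - t" y] x y continuous_on_subset[OF cont subset_UNIV] by fastforce
    then show ?thesis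
      using upper_level_set_sets[OF Z] by (auto simp: distribution_function_def)
  qed
qed

text \<open>The sum counts the grid points \<open>-K + real i * d\<close> strictly below
  \<open>x\<close>; hence \<open>s\<close> is \<open>x\<close> rounded up to the grid, with error at
  most one mesh width.\<close>

lemma layer_approximation:
  fixes x K :: real
  assumes n: "0 < n" and x: "\<bar>x\<bar> \<le> K" and K: "0 < K"
  defines "d \<equiv> 2 * K / real n"
  defines "s \<equiv> (\<Sum>i<n. d * indicator {-K + real i * d<..} x) - K"
  shows "x \<le> s" "s \<le> x + d"
proof -
  define m where "m = nat \<lceil>(x + K) / d\<rceil>"
  have d: "0 < d"
    using n K by (simp add: d_def)
  \<comment> \<open>The lower bound keeps \<open>nat\<close> from truncating; the upper one makes
    \<open>n\<close> layers enough, that is \<open>m \<le> n\<close>.\<close>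
  have q: "0 \<le> (x + K) / d" "(x + K) / d \<le> real n"
    using x d n K by (auto simp: abs_le_iff pos_divide_le_eq intro!: divide_nonneg_pos)
      (simp add: d_def)
  then have mn: "m \<le> n"
    by (simp add: m_def ceiling_le_iff nat_le_iff)
  have "(indicator {-K + real i * d<..} x :: real) = indicator {..<m} i" for i
  proof -
    have "-K + real i * d < x \<longleftrightarrow> real i < (x + K) / d"
      using d by (simp add: field_simps)
    also have "\<dots> \<longleftrightarrow> i < m"
      unfolding m_def by (simp add: less_ceiling_iff zless_nat_eq_int_zless)
    finally show ?thesis by (simp add: indicator_def)
  qed
  then have "s = d * (\<Sum>i<n. indicator {..<m} i) - K"
    by (simp add: s_def sum_distrib_left)
  also have "(\<Sum>i<n. indicator {..<m} i) = real m"
    using mn by (simp add: indicator_def sum.If_cases Int_absorb1 lessThan_subset_iff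
        flip: lessThan_def)
  finally have s: "s = d * real m - K" .
  have "(x + K) / d \<le> real m" "real m \<le> (x + K) / d + 1"
    using q(1) unfolding m_def by linarith+
  then show "x \<le> s" "s \<le> x + d"
    using d by (auto simp: s field_simps)
qed

section \<open>Representation\<close>

text \<open>Every axiom is read at a single point \<open>\<omega>\<close>, so the representation can
  be proved for each \<open>\<omega>\<close> separately, as for a deterministic functional.\<close>

locale comonotonic_risk_measure =
  fixes F :: "'a measure" and c :: "'a set \<Rightarrow> real" and \<rho> :: "('a \<Rightarrow> real) \<Rightarrow> ('a \<Rightarrow> real)"
  assumes capacity: "capacity F c"
    and dominated: "X \<in> bounded_measurable F \<Longrightarrow> Y \<in> bounded_measurable F \<Longrightarrow>
        st_dominated F c X Y \<Longrightarrow> \<omega> \<in> space F \<Longrightarrow> \<rho> X \<omega> \<le> \<rho> Y \<omega>"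
    and additive: "X \<in> bounded_measurable F \<Longrightarrow> Y \<in> bounded_measurable F \<Longrightarrow>
        comonotonic F X Y \<Longrightarrow> \<omega> \<in> space F \<Longrightarrow> \<rho> (\<lambda>\<omega>'. X \<omega>' + Y \<omega>') \<omega> = \<rho> X \<omega> + \<rho> Y \<omega>"
    and translation: "X \<in> bounded_measurable F \<Longrightarrow> \<omega> \<in> space F \<Longrightarrow>
        \<rho> (\<lambda>\<omega>'. X \<omega>' + a) \<omega> = \<rho> X \<omega> + a"
    and homogeneous: "X \<in> bounded_measurable F \<Longrightarrow> a \<ge> 0 \<Longrightarrow> \<omega> \<in> space F \<Longrightarrow>
        \<rho> (\<lambda>\<omega>'. a * X \<omega>') \<omega> = a * \<rho> X \<omega>"
begin

section \<open>Values on constants and indicators\<close>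

lemma zero: "\<omega> \<in> space F \<Longrightarrow> \<rho> (\<lambda>_. 0) \<omega> = 0"
  using homogeneous[of "\<lambda>_. 0" 0 \<omega>] bounded_measurableI[of "\<lambda>_. 0" F 0] by simp

lemma monotone:
  assumes "X \<in> bounded_measurable F" "Y \<in> bounded_measurable F"
    and "\<And>\<omega>. \<omega> \<in> space F \<Longrightarrow> X \<omega> \<le> Y \<omega>" "\<omega> \<in> space F"
  shows "\<rho> X \<omega> \<le> \<rho> Y \<omega>"
  using assms by (intro dominated st_dominated_pointwise capacity)

text \<open>Used in both directions for sets of equal capacity, this makes
  \<open>\<rho> (indicator A) \<omega>\<close> a function of \<open>c A\<close>.\<close>

lemma indicator_mono:
  assumes "A \<in> sets F" "B \<in> sets F" "c A \<le> c B" "\<omega> \<in> space F"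
  shows "\<rho> (indicator A) \<omega> \<le> \<rho> (indicator B) \<omega>"
  using assms by (intro dominated st_dominated_indicator bounded_measurable_indicator capacity)

lemma indicator_empty: "\<omega> \<in> space F \<Longrightarrow> \<rho> (indicator {}) \<omega> = 0"
  using zero by (simp add: indicator_def[abs_def])

lemma indicator_space:
  assumes "\<omega> \<in> space F"
  shows "\<rho> (indicator (space F)) \<omega> = 1"
proof -
  have bm: "(\<lambda>_. k) \<in> bounded_measurable F" for k :: real
    by (rule bounded_measurableI[where K = "\<bar>k\<bar>"]) auto
  \<comment> \<open>As total functions the two may differ off \<open>space F\<close>; monotonicity
    in both directions identifies their values under \<open>\<rho>\<close>.\<close>
  have "\<rho> (indicator (space F)) \<omega> = \<rho> (\<lambda>_. 1) \<omega>"
    using assms by (intro antisym monotone bm bounded_measurable_indicator) auto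
  also have "\<dots> = 1"
    using translation[OF bm, of \<omega> 0 1] zero[OF assms] assms by simp
  finally show ?thesis .
qed

text \<open>Layers are split off one at a time: the partial sum and the next layer are both
  non-decreasing functions of the same \<open>X\<close>, hence comonotonic, so additivity applies;
  homogeneity then extracts \<open>d\<close>.\<close>

lemma layer_sum:
  fixes X :: "'a \<Rightarrow> real" and n :: nat
  assumes X: "X \<in> borel_measurable F" and d: "0 \<le> d" and \<omega>: "\<omega> \<in> space F"
  shows "(\<lambda>\<omega>'. \<Sum>i<n. d * indicator {a i<..} (X \<omega>')) \<in> bounded_measurable F"
    and "\<rho> (\<lambda>\<omega>'. \<Sum>i<n. d * indicator {a i<..} (X \<omega>')) \<omega> =
      (\<Sum>i<n. d * \<rho> (indicator {\<omega>'\<in>space F. X \<omega>' > a i}) \<omega>)"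
proof -
  have bm: "(\<lambda>\<omega>'. \<Sum>i<m. d * indicator {a i<..} (X \<omega>')) \<in> bounded_measurable F" for m :: nat
  proof (rule bounded_measurableI[where K = "\<Sum>i<m. d"])
    show "(\<lambda>\<omega>'. \<Sum>i<m. d * indicator {a i<..} (X \<omega>')) \<in> borel_measurable F"
      using X by measurable
    show "\<bar>\<Sum>i<m. d * indicator {a i<..} (X \<omega>')\<bar> \<le> (\<Sum>i<m. d)" for \<omega>'
      using d by (intro sum_abs[THEN order_trans] sum_mono) (auto simp: indicator_def)
  qed
  show "(\<lambda>\<omega>'. \<Sum>i<n. d * indicator {a i<..} (X \<omega>')) \<in> bounded_measurable F"
    by (rule bm)
  show "\<rho> (\<lambda>\<omega>'. \<Sum>i<n. d * indicator {a i<..} (X \<omega>')) \<omega> =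
      (\<Sum>i<n. d * \<rho> (indicator {\<omega>'\<in>space F. X \<omega>' > a i}) \<omega>)"
  proof (induction n)
    case 0
    then show ?case using zero[OF \<omega>] by simp
  next
    case (Suc n)
    have ind: "(\<lambda>\<omega>'. indicator {a n<..} (X \<omega>') :: real) \<in> bounded_measurable F"
      using X by (intro bounded_measurableI[where K = 1]) (measurable, auto simp: indicator_def)
    then have scaled: "(\<lambda>\<omega>'. d * indicator {a n<..} (X \<omega>')) \<in> bounded_measurable F"
      using d by (intro bounded_measurable_mono_comp[where u = "\<lambda>x. d * x"])
        (auto simp: mono_def mult_left_mono)
    have step: "mono (indicator {a i<..} :: real \<Rightarrow> real)" for i
      by (auto simp: mono_def indicator_def)
    have "comonotonic F (\<lambda>\<omega>'. \<Sum>i<n. d * indicator {a i<..} (X \<omega>'))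
        (\<lambda>\<omega>'. d * indicator {a n<..} (X \<omega>'))"
      using d monoD[OF step]
      by (intro comonotonic_mono_comp[where g = "\<lambda>x. d * indicator {a n<..} x"
            and f = "\<lambda>x. \<Sum>i<n. d * indicator {a i<..} x"] monoI sum_mono mult_left_mono)
    then have "\<rho> (\<lambda>\<omega>'. \<Sum>i<Suc n. d * indicator {a i<..} (X \<omega>')) \<omega> =
        \<rho> (\<lambda>\<omega>'. \<Sum>i<n. d * indicator {a i<..} (X \<omega>')) \<omega> +
        \<rho> (\<lambda>\<omega>'. d * indicator {a n<..} (X \<omega>')) \<omega>"
      using additive[OF bm scaled _ \<omega>] by simp
    also have "\<rho> (\<lambda>\<omega>'. d * indicator {a n<..} (X \<omega>')) \<omega> =
        d * \<rho> (\<lambda>\<omega>'. indicator {a n<..} (X \<omega>')) \<omega>"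
      by (rule homogeneous[OF ind d \<omega>])
    also have "\<rho> (\<lambda>\<omega>'. indicator {a n<..} (X \<omega>')) \<omega> =
        \<rho> (indicator {\<omega>'\<in>space F. X \<omega>' > a n}) \<omega>"
      using bounded_measurable_indicator[OF upper_level_set_sets[OF X]] ind \<omega>
      by (intro antisym monotone) (auto simp: indicator_def)
    finally show ?case
      using Suc.IH by simp
  qed
qed

lemma representation:
  assumes \<phi>: "mono_on {0..1} \<phi>" "\<phi> 0 = 0" "\<phi> 1 = 1"
    and \<omega>: "\<omega> \<in> space F"
    and ind: "\<And>A. A \<in> sets F \<Longrightarrow> \<rho> (indicator A) \<omega> = \<phi> (c A)"
    and X: "X \<in> bounded_measurable F"
  shows "\<rho> X \<omega> = (LBINT x:{0..}. \<phi> (c {\<omega>'\<in>space F. X \<omega>' > x})) +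
    (LBINT x:{..0}. (\<phi> (c {\<omega>'\<in>space F. X \<omega>' > x}) - 1))"
proof -
  define h where "h x = \<phi> (c {\<omega>'\<in>space F. X \<omega>' > x})" for x
  note Xm = bounded_measurableD(1)[OF X]
  obtain K where K: "K > 0" "\<And>\<omega>. \<omega> \<in> space F \<Longrightarrow> \<bar>X \<omega>\<bar> \<le> K"
    using bounded_measurableD(2)[OF X] by auto
  have tail: "tail_function K h"
    unfolding h_def by (rule tail_function_capacity[OF capacity Xm K(2) \<phi>])
  then have anti: "antimono h"
    by (simp add: tail_function_def)
  \<comment> \<open>\<open>tail_function\<close> prescribes the value 1 only strictly left of
    \<open>-K\<close>, so the bound at \<open>-K\<close> is taken from the point
    \<open>-K - 1\<close>.\<close>
  have hK: "h K = 0" "h (-K) \<le> 1"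
    using tail antimonoD[OF anti, of "-K - 1" "-K"] by (auto simp: tail_function_def)
  let ?I = "integral {-K..K} h - K"
  \<comment> \<open>With \<open>d\<close> the mesh width and \<open>?S\<close> the layer sum, the
    value of \<open>\<rho>\<close> at \<open>?S - K\<close> exceeds \<open>\<rho> X \<omega>\<close>
    by between 0 and \<open>d\<close>. It is also a Riemann sum minus \<open>K\<close>, exceeding
    \<open>?I\<close> by between 0 and \<open>d * h (-K) \<le> d\<close>. So the two differ by at
    most \<open>d\<close>.\<close>
  have close: "\<bar>\<rho> X \<omega> - ?I\<bar> \<le> 2 * K / real n" if n: "0 < n" for n
  proof -
    define d where "d = 2 * K / real n"
    have d: "0 \<le> d" "-K + real n * d = K"
      using K(1) n by (auto simp: d_def)
    let ?S = "\<lambda>\<omega>'. \<Sum>i<n. d * indicator {-K + real i * d<..} (X \<omega>')"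
    have S: "?S \<in> bounded_measurable F"
      by (rule layer_sum(1)[OF Xm d(1) \<omega>])
    have shift: "(\<lambda>\<omega>'. V \<omega>' + b) \<in> bounded_measurable F" if "V \<in> bounded_measurable F" for V b
      using that by (rule bounded_measurable_mono_comp) (simp add: mono_def)
    have "\<rho> ?S \<omega> = d * (\<Sum>i<n. h (-K + real i * d))"
      using layer_sum(2)[OF Xm d(1) \<omega>, of "\<lambda>i. -K + real i * d" n]
      by (simp add: ind upper_level_set_sets[OF Xm] h_def sum_distrib_left)
    then have val: "\<rho> (\<lambda>\<omega>'. ?S \<omega>' + - K) \<omega> = d * (\<Sum>i<n. h (-K + real i * d)) - K"
      using translation[OF S \<omega>, of "-K"] by simp
    have "\<rho> X \<omega> \<le> \<rho> (\<lambda>\<omega>'. ?S \<omega>' + - K) \<omega>"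
      using layer_approximation(1)[OF n K(2) K(1)]
      by (intro monotone[OF X shift[OF S] _ \<omega>]) (simp add: d_def)
    moreover have "\<rho> (\<lambda>\<omega>'. ?S \<omega>' + - K) \<omega> \<le> \<rho> (\<lambda>\<omega>'. X \<omega>' + d) \<omega>"
      using layer_approximation(2)[OF n K(2) K(1)]
      by (intro monotone[OF shift[OF S] shift[OF X] _ \<omega>]) (simp add: d_def)
    moreover have "\<rho> (\<lambda>\<omega>'. X \<omega>' + d) \<omega> = \<rho> X \<omega> + d"
      by (rule translation[OF X \<omega>])
    moreover have "integral {-K..K} h \<le> d * (\<Sum>i<n. h (-K + real i * d))"
        "d * (\<Sum>i<n. h (-K + real i * d)) \<le> integral {-K..K} h + d * h (-K)"
      using antimono_Riemann_sum_bounds[OF anti d(1), of "-K" n] unfolding d(2) by (auto simp: hK)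
    moreover have "d * h (-K) \<le> d"
      using mult_left_mono[OF hK(2) d(1)] by simp
    ultimately show ?thesis
      using val unfolding d_def[symmetric] by linarith
  qed
  have "\<rho> X \<omega> = ?I"
  proof (rule ccontr)
    assume "\<rho> X \<omega> \<noteq> ?I"
    then have e: "0 < \<bar>\<rho> X \<omega> - ?I\<bar>"
      by simp
    \<comment> \<open>This mesh is finer than the supposed gap, contradicting
      \<open>close\<close>.\<close>
    obtain n where n: "2 * K / \<bar>\<rho> X \<omega> - ?I\<bar> < real n"
      using reals_Archimedean2 by blast
    moreover have "0 < 2 * K / \<bar>\<rho> X \<omega> - ?I\<bar>"
      using K(1) e by simp
    ultimately have "0 < n"
      by (metis of_nat_0_less_iff less_trans)
    with close[OF this] n e show False
      by (simp add: field_simps)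
  qed
  then show ?thesis
    using tail_integral_eq[OF tail] K(1) by (simp add: h_def)
qed

end

section \<open>Construction of the random distortion\<close>

theorem theorem2:
  fixes F G :: "'a measure"
    and c :: "'a set \<Rightarrow> real"
    and \<rho> :: "('a \<Rightarrow> real) \<Rightarrow> ('a \<Rightarrow> real)"
  assumes "subalgebra F G"
    and "capacity F c"
    and "continuous_from_below F c"
    and "\<exists>Z \<in> borel_measurable F.
           continuous_on UNIV (distribution_function F c Z) \<and>
           (distribution_function F c Z \<longlongrightarrow> 0) at_bot \<and>
           (distribution_function F c Z \<longlongrightarrow> 1) at_top"
    and "\<rho> \<in> bounded_measurable F \<rightarrow> bounded_measurable G"
    and "\<And>X Y. X \<in> bounded_measurable F \<Longrightarrow> Y \<in> bounded_measurable F \<Longrightarrow>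
           st_dominated F c X Y \<Longrightarrow> \<forall>\<omega>\<in>space F. \<rho> X \<omega> \<le> \<rho> Y \<omega>"
    and "\<And>X Y. X \<in> bounded_measurable F \<Longrightarrow> Y \<in> bounded_measurable F \<Longrightarrow>
           comonotonic F X Y \<Longrightarrow> \<forall>\<omega>\<in>space F. \<rho> (\<lambda>\<omega>'. X \<omega>' + Y \<omega>') \<omega> = \<rho> X \<omega> + \<rho> Y \<omega>"
    and "\<And>X (a :: real). X \<in> bounded_measurable F \<Longrightarrow>
           \<forall>\<omega>\<in>space F. \<rho> (\<lambda>\<omega>'. X \<omega>' + a) \<omega> = \<rho> X \<omega> + a"
    and "\<And>X (a :: real). X \<in> bounded_measurable F \<Longrightarrow> a \<ge> 0 \<Longrightarrow>
           \<forall>\<omega>\<in>space F. \<rho> (\<lambda>\<omega>'. a * X \<omega>') \<omega> = a * \<rho> X \<omega>"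
  shows "\<exists>\<phi>. random_distortion_function G \<phi> \<and>
           (\<forall>X \<in> bounded_measurable F. \<forall>\<omega>\<in>space F.
              \<rho> X \<omega> = distorted_choquet_integral F \<phi> c X \<omega>)"
proof -
  interpret comonotonic_risk_measure F c \<rho>
    using assms(2,6-9) by unfold_locales auto
  have "\<forall>t\<in>{0..1}. \<exists>A\<in>sets F. c A = t"
    using assms(4) capacity_attains[OF capacity] by blast
  then obtain A where A: "\<And>t. t \<in> {0..1} \<Longrightarrow> A t \<in> sets F \<and> c (A t) = t"
    by metis
  \<comment> \<open>One set \<open>A t\<close> is fixed for each capacity \<open>t\<close>, the same
    for all \<open>\<omega>\<close>; thus each section in \<open>\<omega>\<close> is a single value
    of the operator \<open>\<rho>\<close>, which gives measurability with respect to
    \<open>G\<close>.\<close>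
  define \<phi> where "\<phi> \<omega> t = \<rho> (indicator (A t)) \<omega>" for \<omega> t
  have GF: "space G = space F"
    using assms(1) by (simp add: subalgebra_def)
  have ind: "\<rho> (indicator B) \<omega> = \<phi> \<omega> (c B)" if "B \<in> sets F" "\<omega> \<in> space F" for B \<omega>
    unfolding \<phi>_def using A[OF capacity_range[OF capacity that(1)]] that
    by (intro antisym indicator_mono) auto
  \<comment> \<open>\<open>A 0\<close> may be a non-empty set of capacity 0, and \<open>A 1\<close>
    a proper subset of the space; \<open>ind\<close> transfers the values from the empty set and the
    whole space.\<close>
  have ends: "\<phi> \<omega> 0 = 0" "\<phi> \<omega> 1 = 1" if "\<omega> \<in> space F" for \<omega>
    using ind[of "{}" \<omega>] ind[of "space F" \<omega>] indicator_empty indicator_space capacity that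
    by (auto simp: capacity_def)
  have mono: "mono_on {0..1} (\<phi> \<omega>)" if "\<omega> \<in> space F" for \<omega>
    unfolding \<phi>_def using A that by (intro mono_onI indicator_mono) auto
  have range: "\<phi> \<omega> t \<in> {0..1}" if "\<omega> \<in> space F" "t \<in> {0..1}" for \<omega> t
    using mono_onD[OF mono[OF that(1)], of 0 t] mono_onD[OF mono[OF that(1)], of t 1]
      ends[OF that(1)] that(2) by auto
  have meas: "(\<lambda>\<omega>. \<phi> \<omega> t) \<in> borel_measurable G" if "t \<in> {0..1}" for t
  proof -
    have "\<rho> (indicator (A t)) \<in> bounded_measurable G"
      using A[OF that] assms(5) bounded_measurable_indicator by blast
    then show ?thesis
      using bounded_measurableD(1) by (simp add: \<phi>_def)
  qed
  have "random_distortion_function G \<phi>"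
    unfolding random_distortion_function_def GF using mono ends range meas by blast
  moreover have "\<forall>X\<in>bounded_measurable F. \<forall>\<omega>\<in>space F.
      \<rho> X \<omega> = distorted_choquet_integral F \<phi> c X \<omega>"
    unfolding distorted_choquet_integral_def using representation mono ends ind by blast
  ultimately show ?thesis
    by blast
qed

end
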